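(* Let $m \ge 2$ be an integer, let $l_1, \ldots, l_m, u_1, \ldots, u_m \in \mathbb{R}$, and let $x_1, \ldots, x_m, y \in \mathbb{R}$ with $l_i \le x_i \le u_i$ for all $i \in \{1, \ldots, m\}$. For each $i$ define $u_{\max, -i} = \max_{j \ne i} u_j$. Then $y = \max(x_1, x_2, \ldots, x_m)$ if and only if there exist $a_1, \ldots, a_m \in \{0, 1\}$ with $\sum_{i=1}^m a_i = 1$ such that, for every $i \in \{1, \ldots, m\}$, $$ y \le x_i + (1 - a_i)(u_{\max, -i} - l_i) \qquad \text{and} \qquad y \ge x_i. $$
   Context: The bounds $l_i \le x_i \le u_i$ are a priori bounds on the inputs of the maximum function. The $a_i$ are binary indicator decision variables, where $a_i = 1$ is intended to imply $y = x_i$. *)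

theory Defs
  imports Complex_Main
begin

definition umax_except :: "nat \<Rightarrow> (nat \<Rightarrow> real) \<Rightarrow> nat \<Rightarrow> real" where
  "umax_except m u i = Max (u ` ({1..m} - {i}))"

end

theory Submission
  imports Defs
begin

text \<open>The constraints \<open>y \<ge> x i\<close> make \<open>y\<close> an upper bound of the
  inputs, and the index with \<open>a i = 1\<close> switches off its big-M term, which forces
  \<open>y\<close> down to that input. Conversely, let \<open>a\<close> select an index
  \<open>k\<close> attaining the maximum. The other upper constraints are then slack, since for
  \<open>i \<noteq> k\<close> the chain y = x_k \<le> u_k \<le> u_{max,-i} \<le> x_i + (u_{max,-i} -
  l_i) holds.\<close>

theorem mainTheorem2:
  fixes m :: nat and l u x :: "nat \<Rightarrow> real" and y :: real
  assumes "m \<ge> 2"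
    and "\<forall>i\<in>{1..m}. l i \<le> x i \<and> x i \<le> u i"
  shows "y = Max (x ` {1..m}) \<longleftrightarrow>
    (\<exists>a :: nat \<Rightarrow> real.
        (\<forall>i\<in>{1..m}. a i \<in> {0, 1}) \<and>
        (\<Sum>i=1..m. a i) = 1 \<and>
        (\<forall>i\<in>{1..m}. y \<le> x i + (1 - a i) * (umax_except m u i - l i) \<and> y \<ge> x i))"
    (is "?L \<longleftrightarrow> ?R")
proof
  assume y: ?L
  have "Max (x ` {1..m}) \<in> x ` {1..m}"
    using assms(1) by (intro Max_in) auto
  then obtain k where k: "k \<in> {1..m}" "y = x k"
    using y by auto
  have ge: "x i \<le> y" if "i \<in> {1..m}" for i
    using that y by simp
  \<comment> \<open>Only the one chosen maximizer is marked, so ties do not spoil the sum.\<close>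
  define a :: "nat \<Rightarrow> real" where "a i = (if i = k then 1 else 0)" for i
  have "y \<le> x i + (1 - a i) * (umax_except m u i - l i)" if i: "i \<in> {1..m}" for i
  proof (cases "i = k")
    case True
    then show ?thesis using k by (simp add: a_def)
  next
    case False
    \<comment> \<open>Leaving out \<open>i\<close> keeps \<open>k\<close> among the indices of the
      maximum.\<close>
    then have "u k \<le> umax_except m u i"
      unfolding umax_except_def using k by (intro Max_ge) auto
    moreover have "x k \<le> u k" "l i \<le> x i"
      using assms(2) k i by auto
    ultimately show ?thesis using k False by (simp add: a_def)
  qed
  moreover have "(\<Sum>i=1..m. a i) = 1"
    using k by (simp add: a_def)
  ultimately show ?R
    using ge by (intro exI[of _ a]) (auto simp: a_def)
next
  assume ?R
  then obtain a :: "nat \<Rightarrow> real" where a: "\<forall>i\<in>{1..m}. a i \<in> {0, 1}" "(\<Sum>i=1..m. a i) = 1"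
    and bnd: "\<forall>i\<in>{1..m}. y \<le> x i + (1 - a i) * (umax_except m u i - l i) \<and> y \<ge> x i"
    by blast
  \<comment> \<open>If every \<open>a i\<close> were zero, the sum would be 0 rather than 1.\<close>
  obtain k where k: "k \<in> {1..m}" "a k \<noteq> 0"
    using a(2) by (metis sum.neutral zero_neq_one)
  then have "a k = 1"
    using a(1) by auto
  \<comment> \<open>At \<open>k\<close> the big-M term vanishes and the two bounds meet.\<close>
  then have "y = x k"
    using bspec[OF bnd k(1)] by simp
  then show ?L
    using bnd k by (intro Max_eqI[symmetric]) auto
qed

end
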